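(* Let $G$ be a bipartite graph with bipartition $(L,U)$. Consider the online algorithm GreedyOptAdvice which reads $m=\mathrm{Opt}(I)$ (self-delimitingly encoded) from the advice tape and then, for the $i$-th request, to node $v$: if $v\in U$ and $f_{i-1}(v)=\emptyset$, it assigns color $m$; if $v\in U$ and $f_{i-1}(v)\neq\emptyset$, it assigns color $\min f_{i-1}(v)-1$; if $v\in L$, it assigns color $\max f_{i-1}(v)+1$ (with $\max\emptyset=0$). This algorithm produces a legal multi-coloring, is strictly $1$-competitive, and has advice complexity $[\![\mathrm{Opt}]\!]$.
   Context: Online multi-coloring: the graph is known in advance; requests arrive one at a time, each naming a node $v$, and must immediately and irrevocably receive a color (positive integer) different from every color previously assigned to $v$ or any neighbor of $v$. $\mathrm{Opt}(I)$ is the minimum number of colors an offline algorithm needs on the request sequence $I$. $f_i(v)$ denotes the set of colors assigned to node $v$ after the first $i$ requests ($f_0(v)=\emptyset$). Advice model: an all-powerful oracle writes an infinite binary advice tape; advice complexity is the maximum index of a bit read. Strictly $1$-competitive means $A(I)\le \mathrm{Opt}(I)$ for all $I$. $[\![x]\!]$ denotes the minimum number of bits needed to encode the non-negative integer $x$ in a self-delimiting way (so that the reader knows where the encoding ends); e.g.\ it is at most $\lceil\log(\lceil\log(x+1)\rceil+1)\rceil+1+\lceil\log(\lceil\log(x+1)\rceil+1)\rceil+\lceil\log(x+1)\rceil$. *)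

theory Defs
  imports "HOL-Library.Sublist" "Graph_Theory.Graph_Theory" Complex_Main
begin

section \<open>Bipartite graphs and multi-colorings\<close>

definition bipartition :: "'v pair_pre_digraph \<Rightarrow> 'v set \<Rightarrow> 'v set \<Rightarrow> bool" where
  "bipartition G L U \<longleftrightarrow>
     pverts G = L \<union> U \<and> L \<inter> U = {} \<and> parcs G \<subseteq> (L \<times> U) \<union> (U \<times> L)"

text \<open>
  A request sequence is a list \<open>I\<close> of nodes; an answer to it is a list \<open>cs\<close> of colors,
  \<open>cs ! i\<close> being given to the request \<open>I ! i\<close>.  Counting from 1 as in the literature,
  \<open>assigned I cs i v\<close> is $f_i(v)$, and \<open>I ! i\<close> is the request number $i+1$.
\<close>

definition assigned :: "'v list \<Rightarrow> nat list \<Rightarrow> nat \<Rightarrow> 'v \<Rightarrow> nat set" where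
  "assigned I cs i v = {cs ! j | j. j < i \<and> I ! j = v}"

definition legal_coloring :: "'v pair_pre_digraph \<Rightarrow> 'v list \<Rightarrow> nat list \<Rightarrow> bool" where
  "legal_coloring G I cs \<longleftrightarrow>
     length cs = length I \<and>
     (\<forall>i<length I. cs ! i \<ge> 1 \<and> cs ! i \<notin> assigned I cs i (I ! i) \<and>
        (\<forall>u. (u, I ! i) \<in> parcs G \<longrightarrow> cs ! i \<notin> assigned I cs i u))"

definition num_colors :: "nat list \<Rightarrow> nat" where
  "num_colors cs = card (set cs)"

definition Opt :: "'v pair_pre_digraph \<Rightarrow> 'v list \<Rightarrow> nat" where
  "Opt G I = (LEAST k. \<exists>cs. legal_coloring G I cs \<and> num_colors cs = k)"


section \<open>Online algorithms with advice\<close>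

type_synonym tape = "nat \<Rightarrow> bool"

text \<open>
  A computation with access to the advice tape: it either returns a value, or queries the
  tape cell \<open>i\<close> and continues depending on the bit found there.  The type is coinductive since
  a computation may go on reading forever on some tapes.
\<close>

codatatype 'a comp = Return 'a | Query nat "bool \<Rightarrow> 'a comp"

text \<open>
  The result of a computation on a tape together with the set of cells read;
  \<open>None\<close> means that the computation does not terminate.
\<close>

partial_function (option) run :: "tape \<Rightarrow> 'a comp \<Rightarrow> ('a \<times> nat set) option" where
  "run \<phi> c = (case c of
      Return x \<Rightarrow> Some (x, {})
    | Query i k \<Rightarrow> Option.bind (run \<phi> (k (\<phi> i))) (\<lambda>(x, R). Some (x, insert i R)))"

text \<open>
  An online algorithm may read advice before the first request (\<open>start\<close>) and at every
  request (\<open>respond\<close>).  \<open>respond\<close> sees the internal state, the sets of colors assigned to the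
  nodes so far, and the current node; it returns the color and the new state.
\<close>

record ('v, 's) online_alg =
  start :: "'s comp"
  respond :: "'s \<Rightarrow> ('v \<Rightarrow> nat set) \<Rightarrow> 'v \<Rightarrow> (nat \<times> 's) comp"

fun serve :: "('v, 's) online_alg \<Rightarrow> tape \<Rightarrow> 's \<Rightarrow> ('v \<Rightarrow> nat set) \<Rightarrow> 'v list \<Rightarrow>
    (nat list \<times> nat set) option" where
  "serve A \<phi> s f [] = Some ([], {})"
| "serve A \<phi> s f (v # vs) =
     Option.bind (run \<phi> (respond A s f v)) (\<lambda>((c, s'), R).
     Option.bind (serve A \<phi> s' (f(v := insert c (f v))) vs) (\<lambda>(cs, R').
     Some (c # cs, R \<union> R')))"

definition execute :: "('v, 's) online_alg \<Rightarrow> tape \<Rightarrow> 'v list \<Rightarrow> (nat list \<times> nat set) option" where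
  "execute A \<phi> I =
     Option.bind (run \<phi> (start A)) (\<lambda>(s, R).
     Option.bind (serve A \<phi> s (\<lambda>_. {}) I) (\<lambda>(cs, R').
     Some (cs, R \<union> R')))"

text \<open>
  The maximum index of a bit read, the bits on the tape being numbered from 1
  (so cell \<open>i\<close> holds bit number \<open>i + 1\<close>), and 0 if nothing is read.
\<close>

definition max_index :: "nat set \<Rightarrow> nat" where
  "max_index R = Max (insert 0 (Suc ` R))"

text \<open>
  In the following, the oracle \<open>\<O>\<close> maps a request sequence to the advice tape written for it.
\<close>

definition produces_legal_coloring ::
    "'v pair_pre_digraph \<Rightarrow> ('v, 's) online_alg \<Rightarrow> ('v list \<Rightarrow> tape) \<Rightarrow> bool" where
  "produces_legal_coloring G A \<O> \<longleftrightarrow>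
     (\<forall>I\<in>lists (pverts G). \<exists>cs R. execute A (\<O> I) I = Some (cs, R) \<and> legal_coloring G I cs)"

definition strictly_1_competitive ::
    "'v pair_pre_digraph \<Rightarrow> ('v, 's) online_alg \<Rightarrow> ('v list \<Rightarrow> tape) \<Rightarrow> bool" where
  "strictly_1_competitive G A \<O> \<longleftrightarrow>
     (\<forall>I\<in>lists (pverts G). \<exists>cs R. execute A (\<O> I) I = Some (cs, R) \<and> num_colors cs \<le> Opt G I)"

definition has_advice_complexity ::
    "'v pair_pre_digraph \<Rightarrow> ('v, 's) online_alg \<Rightarrow> ('v list \<Rightarrow> tape) \<Rightarrow> ('v list \<Rightarrow> nat) \<Rightarrow> bool" where
  "has_advice_complexity G A \<O> b \<longleftrightarrow>
     (\<forall>I\<in>lists (pverts G). \<exists>cs R. execute A (\<O> I) I = Some (cs, R) \<and> max_index R = b I)"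


section \<open>Self-delimiting encodings\<close>

text \<open>
  An encoding is given by its decoder: \<open>D w = Some x\<close> means that the bit string \<open>w\<close> is a
  codeword for \<open>x\<close>.  A number may have several codewords.
\<close>

definition self_delimiting :: "(bool list \<Rightarrow> nat option) \<Rightarrow> bool" where
  "self_delimiting D \<longleftrightarrow>
     (\<forall>x. \<exists>w. D w = Some x) \<and>
     (\<forall>w w'. D w \<noteq> None \<longrightarrow> D w' \<noteq> None \<longrightarrow> prefix w w' \<longrightarrow> w = w')"

definition code_length :: "(bool list \<Rightarrow> nat option) \<Rightarrow> nat \<Rightarrow> nat" where
  "code_length D x = (LEAST n. \<exists>w. D w = Some x \<and> length w = n)"

text \<open>Read the tape from its beginning until a codeword is complete.\<close>

primcorec read_from :: "(bool list \<Rightarrow> nat option) \<Rightarrow> bool list \<Rightarrow> nat comp" where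
  "read_from D w = (case D w of
      Some x \<Rightarrow> Return x
    | None \<Rightarrow> Query (length w) (\<lambda>b. read_from D (w @ [b])))"

definition read_number :: "(bool list \<Rightarrow> nat option) \<Rightarrow> nat comp" where
  "read_number D = read_from D []"

text \<open>The tape starts with a shortest codeword for \<open>x\<close>; what comes after it is arbitrary.\<close>

definition starts_with_code :: "(bool list \<Rightarrow> nat option) \<Rightarrow> nat \<Rightarrow> tape \<Rightarrow> bool" where
  "starts_with_code D x \<phi> \<longleftrightarrow> D (map \<phi> [0..<code_length D x]) = Some x"

definition writes_Opt ::
    "'v pair_pre_digraph \<Rightarrow> (bool list \<Rightarrow> nat option) \<Rightarrow> ('v list \<Rightarrow> tape) \<Rightarrow> bool" where
  "writes_Opt G D \<O> \<longleftrightarrow> (\<forall>I\<in>lists (pverts G). starts_with_code D (Opt G I) (\<O> I))"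

lemma ex_writes_Opt:
  assumes "self_delimiting D"
  shows "\<exists>\<O>. writes_Opt G D \<O>"
proof -
  have "\<exists>\<phi>. starts_with_code D x \<phi>" for x
  proof -
    have "\<exists>n w. D w = Some x \<and> length w = n"
      using assms by (auto simp: self_delimiting_def)
    then have "\<exists>w. D w = Some x \<and> length w = code_length D x"
      unfolding code_length_def by (rule LeastI_ex)
    then obtain w where w: "D w = Some x" "length w = code_length D x" by blast
    have "map (\<lambda>i. w ! i) [0..<code_length D x] = w"
      using w(2) by (metis map_nth)
    then have "starts_with_code D x (\<lambda>i. w ! i)"
      using w(1) by (simp add: starts_with_code_def)
    then show ?thesis by blast
  qed
  then have "\<exists>\<O>. \<forall>I. starts_with_code D (Opt G I) (\<O> I)" by (intro choice allI)
  then show ?thesis unfolding writes_Opt_def by blast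
qed


section \<open>The algorithm GreedyOptAdvice\<close>

text \<open>
  The state is the number \<open>m\<close> read from the tape.  On a graph with bipartition \<open>(L, U)\<close>, a
  requested node outside \<open>U\<close> is in \<open>L\<close>.  Subtraction is truncated, but this cannot hide
  an error: color 0 is not legal.
\<close>

definition GreedyOptAdvice ::
    "(bool list \<Rightarrow> nat option) \<Rightarrow> 'v set \<Rightarrow> ('v, nat) online_alg" where
  "GreedyOptAdvice D U = \<lparr>
     start = read_number D,
     respond = (\<lambda>m f v. Return (
       if v \<in> U then (if f v = {} then m else Min (f v) - 1)
       else (if f v = {} then 0 else Max (f v)) + 1, m)) \<rparr>"


section \<open>A short self-delimiting encoding\<close>

text \<open>
  Writing $l$ for the length of \<open>x\<close> in binary and $k$ for that of $l$, the codeword for \<open>x\<close>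
  consists of $k$ in unary, $l$ with $k$ bits, and \<open>x\<close> with $l$ bits.
\<close>

definition bin_length :: "nat \<Rightarrow> nat" where
  "bin_length x = nat \<lceil>log 2 (real x + 1)\<rceil>"

definition bits :: "nat \<Rightarrow> nat \<Rightarrow> bool list" where
  "bits n x = map (bit x) [0..<n]"

definition short_code :: "nat \<Rightarrow> bool list" where
  "short_code x =
     (let l = bin_length x; k = bin_length l
      in replicate k True @ [False] @ bits k l @ bits l x)"

definition short_decode :: "bool list \<Rightarrow> nat option" where
  "short_decode w = (if w \<in> range short_code then Some (inv short_code w) else None)"

lemma less_bin_length: "x < 2 ^ bin_length x"
proof -
  have "log 2 (real x + 1) \<le> real (bin_length x)"
    unfolding bin_length_def by linarith
  then have "real x + 1 \<le> 2 powr real (bin_length x)"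
    by (simp add: log_le_iff)
  then have "real (x + 1) \<le> real (2 ^ bin_length x)"
    by (simp add: powr_realpow add.commute)
  then show ?thesis by linarith
qed

lemma bits_inj:
  assumes "bits n x = bits n y" "x < 2 ^ n" "y < 2 ^ n"
  shows "x = y"
proof -
  have "bit x i = bit y i" if "i < n" for i
    using assms(1) that by (simp add: bits_def)
  then have "take_bit n x = take_bit n y"
    by (intro bit_eqI) (auto simp: bit_take_bit_iff)
  then show ?thesis using assms(2,3) by (simp add: take_bit_nat_eq_self)
qed

lemma short_code_prefix:
  assumes "prefix (short_code x) (short_code y)"
  shows "x = y"
proof -
  define l l' where "l = bin_length x" and "l' = bin_length y"
  define k k' where "k = bin_length l" and "k' = bin_length l'"
  obtain z where z: "replicate k' True @ False # bits k' l' @ bits l' y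
      = replicate k True @ False # bits k l @ bits l x @ z"
    using assms by (auto simp: prefix_def short_code_def Let_def k_def k'_def l_def l'_def)
  have tw: "length (takeWhile id (replicate n True @ False # r)) = n" for n r
    by (induction n) auto
  have k: "k' = k" using arg_cong[OF z, of "\<lambda>w. length (takeWhile id w)"] by (simp only: tw)
  have len: "length (bits n a) = n" for n a by (simp add: bits_def)
  from z k have 1: "bits k l' @ bits l' y = bits k l @ bits l x @ z" by simp
  then have "bits k l' = bits k l" by (simp add: append_eq_append_conv len)
  then have l: "l' = l"
    using bits_inj less_bin_length k unfolding k_def k'_def by metis
  from 1 l have "bits l y = bits l x" by (auto simp: append_eq_append_conv2 len dest: arg_cong[of _ _ length])
  then show ?thesis
    using bits_inj less_bin_length l unfolding l_def l'_def by metis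
qed

lemma short_decode_code: "short_decode (short_code x) = Some x"
proof -
  have "inj short_code" by (intro injI short_code_prefix) simp
  then show ?thesis by (simp add: short_decode_def)
qed

lemma self_delimiting_short_decode: "self_delimiting short_decode"
  unfolding self_delimiting_def
proof (intro conjI allI impI)
  show "\<exists>w. short_decode w = Some x" for x using short_decode_code by blast
next
  fix w w' assume "short_decode w \<noteq> None" "short_decode w' \<noteq> None" "prefix w w'"
  then show "w = w'"
    by (auto simp: short_decode_def split: if_splits dest: short_code_prefix)
qed

lemma code_length_short_decode:
  "int (code_length short_decode x) \<le>
     \<lceil>log 2 (\<lceil>log 2 (real x + 1)\<rceil> + 1)\<rceil> + 1 + \<lceil>log 2 (\<lceil>log 2 (real x + 1)\<rceil> + 1)\<rceil>
     + \<lceil>log 2 (real x + 1)\<rceil>"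
proof -
  have nn: "0 \<le> \<lceil>log 2 (real y + 1)\<rceil>" for y
  proof -
    have "0 \<le> log 2 (real y + 1)" by simp
    then show ?thesis by linarith
  qed
  have b: "int (bin_length y) = \<lceil>log 2 (real y + 1)\<rceil>" for y
    using nn[of y] by (simp add: bin_length_def)
  have "code_length short_decode x \<le> length (short_code x)"
    unfolding code_length_def by (rule Least_le) (use short_decode_code in blast)
  also have "\<dots> = bin_length (bin_length x) + 1 + bin_length (bin_length x) + bin_length x"
    by (simp add: short_code_def Let_def bits_def)
  finally have "int (code_length short_decode x) \<le>
      int (bin_length (bin_length x)) + 1 + int (bin_length (bin_length x)) + int (bin_length x)"
    by linarith
  moreover have "int (bin_length (bin_length x)) = \<lceil>log 2 (\<lceil>log 2 (real x + 1)\<rceil> + 1)\<rceil>"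
  proof -
    have "real (bin_length x) = real_of_int \<lceil>log 2 (real x + 1)\<rceil>"
      using b[of x] by (metis of_int_of_nat_eq)
    then show ?thesis using b[of "bin_length x"] by simp
  qed
  ultimately show ?thesis using b[of x] by simp
qed

end

theory Submission
  imports Defs
begin

text \<open>
  In a legal coloring the colors given to requests at the endpoints of an edge are pairwise
  distinct, so the endpoints together receive at most \<open>m = Opt(I)\<close> requests.  Greedy colors a
  node of \<open>L\<close> with \<open>c\<close> requests by \<open>1, \<dots>, c\<close> and a node of \<open>U\<close> with \<open>d\<close> requests by
  \<open>m, \<dots>, m - d + 1\<close>; these intervals are disjoint for adjacent nodes because \<open>c + d \<le> m\<close>.
\<close>

text \<open>Positions instead of a count, so that the requests to two adjacent nodes can be united
  into one set of conflicting requests.\<close>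

definition occs :: "'v list \<Rightarrow> nat \<Rightarrow> 'v \<Rightarrow> nat set" where
  "occs I i v = {j. j < i \<and> I ! j = v}"

lemma finite_occs [simp]: "finite (occs I i v)"
  by (simp add: occs_def)

lemma occs_0 [simp]: "occs I 0 v = {}"
  by (simp add: occs_def)

lemma occs_Suc: "occs I (Suc i) v = (if I ! i = v then insert i (occs I i v) else occs I i v)"
  by (auto simp: occs_def less_Suc_eq)

lemma card_occs_Suc:
  "card (occs I (Suc i) v) = (if I ! i = v then Suc (card (occs I i v)) else card (occs I i v))"
  by (simp add: occs_Suc) (simp add: occs_def)

text \<open>Request \<open>i\<close> itself is counted only on the right. This strict gap is what
  leaves room for the color of the current request.\<close>

lemma card_occs_less:
  assumes "i < n"
  shows "card (occs I i (I ! i)) < card (occs I n (I ! i))"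
proof (rule psubset_card_mono)
  have "i \<in> occs I n (I ! i)" "i \<notin> occs I i (I ! i)"
    using assms by (auto simp: occs_def)
  moreover have "occs I i (I ! i) \<subseteq> occs I n (I ! i)"
    using assms by (auto simp: occs_def)
  ultimately show "occs I i (I ! i) \<subset> occs I n (I ! i)" by blast
qed simp

lemma assigned_0 [simp]: "assigned I cs 0 = (\<lambda>_. {})"
  by (auto simp: assigned_def)

text \<open>Phrased as a function update to match the way \<open>serve\<close> updates its argument
  \<open>f\<close>.\<close>

lemma assigned_Suc:
  "assigned I cs (Suc i) =
     (assigned I cs i)(I ! i := insert (cs ! i) (assigned I cs i (I ! i)))"
  by (rule ext) (auto simp: assigned_def less_Suc_eq)


section \<open>Lower bounds on the optimum\<close>

text \<open>Of two conflicting requests the later one must avoid the color of the earlier, so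
  \<open>cs\<close> is injective on \<open>J\<close>.\<close>

lemma legal_coloring_card_le:
  assumes legal: "legal_coloring G I cs"
    and J: "J \<subseteq> {..<length I}"
    and conflict: "\<And>i j. i \<in> J \<Longrightarrow> j \<in> J \<Longrightarrow> I ! j = I ! i \<or> (I ! j, I ! i) \<in> parcs G"
  shows "card J \<le> num_colors cs"
proof -
  have neq: "cs ! j \<noteq> cs ! i" if "i \<in> J" "j \<in> J" "j < i" for i j
  proof
    assume eq: "cs ! j = cs ! i"
    have "cs ! i \<in> assigned I cs i (I ! j)"
      unfolding assigned_def using that(3) eq by (metis (mono_tags, lifting) mem_Collect_eq)
    then show False
      using legal conflict[OF that(1,2)] J that(1) unfolding legal_coloring_def by auto
  qed
  have "inj_on ((!) cs) J"
    by (rule inj_onI) (metis neq nat_neq_iff)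
  moreover have "(!) cs ` J \<subseteq> set cs"
    using legal J by (auto simp: legal_coloring_def intro!: nth_mem)
  ultimately show ?thesis
    unfolding num_colors_def by (intro card_inj_on_le) auto
qed

lemma ex_optimal_coloring:
  obtains cs where "legal_coloring G I cs" "num_colors cs = Opt G I"
proof -
  \<comment> \<open>A fresh color for every request is legal, so the minimum in \<open>Opt\<close>
    is attained.\<close>
  have "legal_coloring G I [1..<Suc (length I)]"
    by (auto simp: legal_coloring_def assigned_def nth_upt simp del: upt_Suc)
  then have "\<exists>k cs. legal_coloring G I cs \<and> num_colors cs = k" by blast
  then have "\<exists>cs. legal_coloring G I cs \<and> num_colors cs = Opt G I"
    unfolding Opt_def by (rule LeastI_ex)
  then show ?thesis using that by blast
qed

text \<open>Requests to one node conflict pairwise. Unlike the bound for edges, this also covers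
  isolated nodes.\<close>

lemma card_occs_le_Opt: "card (occs I (length I) v) \<le> Opt G I"
proof -
  obtain cs where cs: "legal_coloring G I cs" "num_colors cs = Opt G I"
    using ex_optimal_coloring .
  show ?thesis
    unfolding cs(2)[symmetric] by (rule legal_coloring_card_le[OF cs(1)]) (auto simp: occs_def)
qed

lemma card_occs_adjacent_le_Opt:
  assumes "pair_graph G" "(u, v) \<in> parcs G"
  shows "card (occs I (length I) u) + card (occs I (length I) v) \<le> Opt G I"
proof -
  interpret pair_graph G by fact
  obtain cs where cs: "legal_coloring G I cs" "num_colors cs = Opt G I"
    using ex_optimal_coloring .
  \<comment> \<open>Symmetry gives the conflict in both directions; the absence of loops makes the
    two sets of positions disjoint.\<close>
  have sym: "(v, u) \<in> parcs G" using assms(2) arcs_symmetric by blast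
  have "u \<noteq> v" using assms(2) no_loops' by blast
  then have "card (occs I (length I) u) + card (occs I (length I) v)
      = card (occs I (length I) u \<union> occs I (length I) v)"
    by (intro card_Un_disjoint[symmetric]) (auto simp: occs_def)
  also have "\<dots> \<le> num_colors cs"
    using assms(2) sym by (intro legal_coloring_card_le[OF cs(1)]) (auto simp: occs_def)
  finally show ?thesis using cs(2) by simp
qed


section \<open>The coloring computed by the algorithm\<close>

text \<open>A closed form of the algorithm's answer that depends on request counts only, which
  separates legality from execution.\<close>

definition greedy_color :: "nat \<Rightarrow> 'v set \<Rightarrow> 'v list \<Rightarrow> nat \<Rightarrow> nat" where
  "greedy_color m U I i =
     (if I ! i \<in> U then m - card (occs I i (I ! i)) else Suc (card (occs I i (I ! i))))"

definition greedy_coloring :: "nat \<Rightarrow> 'v set \<Rightarrow> 'v list \<Rightarrow> nat list" where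
  "greedy_coloring m U I = map (greedy_color m U I) [0..<length I]"

lemma length_greedy_coloring [simp]: "length (greedy_coloring m U I) = length I"
  by (simp add: greedy_coloring_def)

lemma nth_greedy_coloring [simp]:
  "i < length I \<Longrightarrow> greedy_coloring m U I ! i = greedy_color m U I i"
  by (simp add: greedy_coloring_def)

lemma assigned_greedy_coloring:
  assumes "\<And>v. card (occs I (length I) v) \<le> m" "i \<le> length I"
  shows "assigned I (greedy_coloring m U I) i v =
    (if v \<in> U then {m - card (occs I i v)<..m} else {1..card (occs I i v)})"
  using assms(2)
proof (induction i)
  case (Suc i)
  \<comment> \<open>With \<open>c\<close> earlier requests, \<open>c < m\<close> ensures that
    inserting \<open>m - c\<close> extends the interval below by one; truncation would break
    this.\<close>
  have "card (occs I i (I ! i)) < m"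
    using card_occs_less[of i "length I" I] assms(1)[of "I ! i"] Suc.prems by linarith
  then show ?case
    using Suc by (auto simp: assigned_Suc card_occs_Suc greedy_color_def)
qed simp

lemma legal_greedy_coloring:
  assumes bip: "bipartition G L U"
    and node: "\<And>v. card (occs I (length I) v) \<le> m"
    and edge: "\<And>u v. (u, v) \<in> parcs G \<Longrightarrow>
      card (occs I (length I) u) + card (occs I (length I) v) \<le> m"
  shows "legal_coloring G I (greedy_coloring m U I)"
proof -
  have mono: "card (occs I i v) \<le> card (occs I (length I) v)" if "i < length I" for i v
    using that by (intro card_mono) (auto simp: occs_def)
  have side: "u \<in> U \<longleftrightarrow> v \<notin> U" if "(u, v) \<in> parcs G" for u v
    using bip that unfolding bipartition_def by blast
  show ?thesis
    unfolding legal_coloring_def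
  proof (intro conjI allI impI)
    fix i assume i: "i < length I"
    note less = card_occs_less[OF i, of I]
    note assigned = assigned_greedy_coloring[OF node less_imp_le[OF i]]
    show "1 \<le> greedy_coloring m U I ! i"
      using i less node[of "I ! i"] by (auto simp: greedy_color_def)
    show "greedy_coloring m U I ! i \<notin> assigned I (greedy_coloring m U I) i (I ! i)"
      using i by (simp add: assigned greedy_color_def)
    fix u assume u: "(u, I ! i) \<in> parcs G"
    show "greedy_coloring m U I ! i \<notin> assigned I (greedy_coloring m U I) i u"
      \<comment> \<open>The neighbor \<open>u\<close> is on the other side. The edge bound on all
        requests, combined with the strict \<open>less\<close>, leaves room for the new color
        between the two intervals.\<close>
      using i side[OF u] edge[OF u] mono[OF i, of u] less
      by (auto simp: assigned greedy_color_def)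
  qed simp
qed

lemma num_colors_greedy_coloring_le:
  assumes "\<And>v. card (occs I (length I) v) \<le> m"
  shows "num_colors (greedy_coloring m U I) \<le> m"
proof -
  have "greedy_color m U I i \<in> {1..m}" if "i < length I" for i
    using card_occs_less[OF that, of I] assms[of "I ! i"] by (auto simp: greedy_color_def)
  then have "set (greedy_coloring m U I) \<subseteq> {1..m}"
    by (auto simp: greedy_coloring_def)
  then have "card (set (greedy_coloring m U I)) \<le> card {1..m}"
    by (intro card_mono) auto
  then show ?thesis by (simp add: num_colors_def)
qed


section \<open>Execution\<close>

lemma run_Return [simp]: "run \<phi> (Return x) = Some (x, {})"
  by (simp add: run.simps)

lemma run_Query:
  "run \<phi> (Query i k) = map_option (\<lambda>(x, R). (x, insert i R)) (run \<phi> (k (\<phi> i)))"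
  by (subst run.simps) (auto split: Option.bind_split option.split)

text \<open>No proper prefix of a codeword is a codeword, so reading stops exactly at the end of the
  code.\<close>

lemma run_read_number:
  assumes "self_delimiting D" "starts_with_code D x \<phi>"
  shows "run \<phi> (read_number D) = Some (x, {..<code_length D x})"
proof -
  define N where "N = code_length D x"
  have N: "D (map \<phi> [0..<N]) = Some x"
    using assms(2) by (simp add: starts_with_code_def N_def)
  have None: "D (map \<phi> [0..<n]) = None" if "n < N" for n
  proof (rule ccontr)
    assume "D (map \<phi> [0..<n]) \<noteq> None"
    moreover have "prefix (map \<phi> [0..<n]) (map \<phi> [0..<N])"
      using that by (intro map_mono_prefix)
        (metis le_add_diff_inverse less_imp_le prefixI upt_add_eq_append zero_le)
    ultimately have "map \<phi> [0..<n] = map \<phi> [0..<N]"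
      using assms(1) N unfolding self_delimiting_def by (metis option.distinct(1))
    then show False using that by (auto dest: arg_cong[of _ _ length])
  qed
  \<comment> \<open>Generalized to \<open>n\<close> bits already read; the induction descends from
    the complete codeword, where nothing more is queried.\<close>
  have "run \<phi> (read_from D (map \<phi> [0..<n])) = Some (x, {n..<N})" if "n \<le> N" for n
    using that
  proof (induction n rule: inc_induct)
    case base
    show ?case using N by (subst read_from.code) simp
  next
    case (step n)
    have "run \<phi> (read_from D (map \<phi> [0..<n] @ [\<phi> n])) = Some (x, {Suc n..<N})"
      using step.IH by simp
    moreover have "insert n {Suc n..<N} = {n..<N}" using step.hyps by auto
    ultimately show ?case
      using None[of n] step.hyps by (subst read_from.code) (simp add: run_Query)
  qed
  from this[of 0] show ?thesis
    by (simp add: read_number_def N_def lessThan_atLeast0)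
qed

text \<open>Generalized to the situation before request \<open>i\<close>, with backward induction on
  \<open>i\<close>: the colors so far are those of the closed form, and no further advice is
  read.\<close>

lemma serve_GreedyOptAdvice:
  assumes "\<And>v. card (occs I (length I) v) \<le> m" "i \<le> length I"
  shows "serve (GreedyOptAdvice D U) \<phi> m (assigned I (greedy_coloring m U I) i) (drop i I)
    = Some (drop i (greedy_coloring m U I), {})"
  using assms(2)
proof (induction i rule: inc_induct)
  case (step i)
  let ?cs = "greedy_coloring m U I"
  let ?v = "I ! i" and ?f = "assigned I (greedy_coloring m U I) i"
  have i: "i < length I" using step.hyps by simp
  have f: "?f ?v =
      (if ?v \<in> U then {m - card (occs I i ?v)<..m} else {1..card (occs I i ?v)})"
    using assigned_greedy_coloring[OF assms(1)] i by simp
  have less: "card (occs I i ?v) < m"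
    using card_occs_less[OF i, of I] assms(1)[of ?v] by linarith
  have Min: "Min {m - c<..m} - 1 = m - c" if "0 < c" "c < m" for c
  proof -
    have "{m - c<..m} = {Suc (m - c)..m}" by auto
    moreover have "Min {Suc (m - c)..m} = Suc (m - c)"
      using that by (intro Min_eqI) auto
    ultimately show ?thesis by simp
  qed
  have Max: "Max {1..c} = c" if "0 < c" for c :: nat
    using that by (intro Max_eqI) auto
  have color: "(if ?v \<in> U then if ?f ?v = {} then m else Min (?f ?v) - 1
      else (if ?f ?v = {} then 0 else Max (?f ?v)) + 1) = ?cs ! i"
  \<comment> \<open>A first request uses the branches for the empty set; later ones need a nonempty
    interval for \<open>Min\<close> and \<open>Max\<close>.\<close>
  proof (cases "card (occs I i ?v) = 0")
    case True
    then show ?thesis using f i by (simp add: greedy_color_def)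
  next
    case False
    define c where "c = card (occs I i ?v)"
    have c: "0 < c" "c < m" using False less by (auto simp: c_def)
    have "?f ?v = (if ?v \<in> U then {m - c<..m} else {1..c})" using f by (simp add: c_def)
    moreover have "{m - c<..m} \<noteq> {}" "{1..c} \<noteq> {}" using c by auto
    ultimately show ?thesis
      using Min[OF c] Max[OF c(1)] i by (simp add: greedy_color_def c_def[symmetric])
  qed
  have "run \<phi> (respond (GreedyOptAdvice D U) m ?f ?v) = Some ((?cs ! i, m), {})"
    unfolding color[symmetric] by (simp add: GreedyOptAdvice_def)
  then show ?case
    using step.IH i
    by (simp add: Cons_nth_drop_Suc[symmetric] assigned_Suc[symmetric] del: nth_greedy_coloring)
qed simp

lemma execute_GreedyOptAdvice:
  assumes "\<And>v. card (occs I (length I) v) \<le> m"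
    and "self_delimiting D" "starts_with_code D m \<phi>"
  shows "execute (GreedyOptAdvice D U) \<phi> I = Some (greedy_coloring m U I, {..<code_length D m})"
proof -
  have "run \<phi> (start (GreedyOptAdvice D U)) = Some (m, {..<code_length D m})"
    using run_read_number[OF assms(2,3)] by (simp add: GreedyOptAdvice_def)
  moreover have "serve (GreedyOptAdvice D U) \<phi> m (\<lambda>_. {}) I = Some (greedy_coloring m U I, {})"
    using serve_GreedyOptAdvice[OF assms(1), of 0] by simp
  ultimately show ?thesis by (simp add: execute_def)
qed

text \<open>Cell \<open>n - 1\<close> holds bit number \<open>n\<close>; for \<open>n = 0\<close>
  the inserted 0 is the maximum.\<close>

lemma max_index_lessThan: "max_index {..<n} = n"
  unfolding max_index_def by (rule Max_eqI) (cases n; auto)+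

theorem theorem4:
  fixes G :: "'v pair_pre_digraph" and L U :: "'v set"
    and D :: "bool list \<Rightarrow> nat option" and \<O> :: "'v list \<Rightarrow> tape"
  assumes "pair_graph G" and "bipartition G L U"
    and "self_delimiting D" and "writes_Opt G D \<O>"
  shows "produces_legal_coloring G (GreedyOptAdvice D U) \<O> \<and>
    strictly_1_competitive G (GreedyOptAdvice D U) \<O> \<and>
    has_advice_complexity G (GreedyOptAdvice D U) \<O> (\<lambda>I. code_length D (Opt G I))"
proof -
  \<comment> \<open>All three claims concern this single run.\<close>
  have "execute (GreedyOptAdvice D U) (\<O> I) I
      = Some (greedy_coloring (Opt G I) U I, {..<code_length D (Opt G I)})"
    if "I \<in> lists (pverts G)" for I
    using assms(4) that
    by (intro execute_GreedyOptAdvice card_occs_le_Opt assms(3)) (simp add: writes_Opt_def)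
  moreover have "legal_coloring G I (greedy_coloring (Opt G I) U I)" for I
    by (intro legal_greedy_coloring[OF assms(2)] card_occs_le_Opt
        card_occs_adjacent_le_Opt[OF assms(1)])
  moreover have "num_colors (greedy_coloring (Opt G I) U I) \<le> Opt G I" for I
    by (intro num_colors_greedy_coloring_le card_occs_le_Opt)
  ultimately show ?thesis
    by (simp add: produces_legal_coloring_def strictly_1_competitive_def
        has_advice_complexity_def max_index_lessThan)
qed

end
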